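(* Let $\alpha>0$ and $\beta>1$. Let $(u_K^k)_{K\in\mathcal{T},\,k\ge0}$ be a (nonnegative) solution to the finite-volume scheme $$\mathrm{m}(K)\frac{u_K^{k+1}-u_K^k}{\triangle t}+\sum_{\sigma\in\mathcal{E}_{{\rm int},K},\,\sigma=K|L}\tau_\sigma\big((u_K^{k+1})^\beta-(u_L^{k+1})^\beta\big)=0,\qquad K\in\mathcal{T},\ k\ge 0,$$ with $\inf_{K\in\mathcal{T}}u_K^0\ge 0$. Then $$E_\alpha^d[u^k]\le\frac{1}{(c_1t^k+c_2)^{(\alpha+1)/(\beta-1)}},\qquad k\ge 0,$$ where $$c_1=(\beta-1)\left(\frac{(\alpha+1)(\alpha+\beta)^2}{4\alpha\beta}\left(\frac{C_b(p,q)}{\alpha+1}\right)^{(\alpha+\beta)/(\alpha+1)}+(\alpha+\beta)\,\triangle t\,E_\alpha^d[u^0]^{(\beta-1)/(\alpha+1)}\right)^{-1},$$ $$c_2=E_\alpha^d[u^0]^{-(\beta-1)/(\alpha+1)},$$ with $p=(\alpha+\beta)/2$, $q=2(\alpha+1)/(\alpha+\beta)$ and $C_b(p,q)=\dfrac{2(pq-1)C_p^q}{(2-q)\xi^{q/2}}$.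
   Context: $\Omega\subset\mathbb{R}^d$ ($d\ge2$) is an open bounded polyhedral set with Lipschitz boundary; $\mathrm{m}$ denotes Lebesgue measure in $\mathbb{R}^d$ or $\mathbb{R}^{d-1}$, $\mathrm{d}$ the Euclidean distance, and $\mathrm{m}(\Omega)=1$. Admissible mesh: a finite family $\mathcal{T}$ of control volumes (open convex polyhedral subsets of $\Omega$ of positive measure, pairwise disjoint, whose closures cover $\overline\Omega$), a family $\mathcal{E}$ of faces (relatively open parts of hyperplanes, of positive $(d-1)$-measure; for each $K\in\mathcal{T}$ there is $\mathcal{E}_K\subset\mathcal{E}$ with $\partial K=\bigcup_{\sigma\in\mathcal{E}_K}\overline\sigma$, and $\mathcal{E}=\bigcup_K\mathcal{E}_K$), and points $(x_K)_{K\in\mathcal{T}}$ with $x_K\in\overline K$, such that for $K\ne L$ either $\overline K\cap\overline L$ has zero $(d-1)$-measure or $\overline K\cap\overline L=\overline\sigma$ for some $\sigma\in\mathcal{E}$, denoted $\sigma=K|L$; in the latter case $x_K\neq x_L$ and the line through $x_K$ and $x_L$ is orthogonal to $\sigma$; and for a boundary face $\sigma\subset\partial\Omega$ of $K$ with $x_K\notin\sigma$, the line through $x_K$ orthogonal to $\sigma$ intersects $\sigma$. $\mathcal{E}_{\rm int}$ is the set of interior faces and $\mathcal{E}_{{\rm int},K}$ the set of interior faces of $K$. $\mathcal{T}$ is an admissible mesh satisfying the regularity requirement: there is $\xi>0$ with $\mathrm{d}(x_K,\sigma)\ge\xi\,\mathrm{d}(x_K,x_L)$ for all $K\in\mathcal{T}$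 and all $\sigma=K|L\in\mathcal{E}_{{\rm int},K}$. For $\sigma=K|L\in\mathcal{E}_{\rm int}$: $d_\sigma=\mathrm{d}(x_K,x_L)$ and $\tau_\sigma=\mathrm{m}(\sigma)/d_\sigma$. The time step is $\triangle t>0$, $t^k=k\triangle t$. $X(\mathcal{T})$ is the space of functions on $\Omega$ constant on each cell; $u^k\in X(\mathcal{T})$ has value $u_K^k$ on $K$. The discrete entropy is $$E_\alpha^d[u]=\frac{1}{\alpha+1}\left(\sum_{K\in\mathcal{T}}\mathrm{m}(K)u_K^{\alpha+1}-\Big(\sum_{K\in\mathcal{T}}\mathrm{m}(K)u_K\Big)^{\alpha+1}\right).$$ $C_p>0$ is the constant (depending only on $d$ and $\Omega$) of the known discrete Poincaré-Wirtinger inequality $\|f-\bar f\|_{L^2(\Omega)}\le C_p\,\xi^{-1/2}|f|_{1,2,\mathcal{T}}$ for all $f\in X(\mathcal{T})$, where $\bar f=\int_\Omega f\,dx$ and $|f|_{1,2,\mathcal{T}}^2=\sum_{\sigma\in\mathcal{E}_{\rm int},\,\sigma=K|L}\tau_\sigma|f_K-f_L|^2$. Known facts about the scheme: for data $0\le m\le u_K^0\le M$ the solution is unique, satisfies $m\le u_K^k\le M$, and conserves $\sum_K\mathrm{m}(K)u_K^k$. If $E_\alpha^d[u^0]=0$, then $c_2=+\infty$ and the right-hand side of the estimate is understood as $0$. *)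

theory Defs
  imports "HOL-Analysis.Analysis"
begin

definition lipschitz_boundary :: "'a::euclidean_space set \<Rightarrow> bool" where
  "lipschitz_boundary \<Omega> \<longleftrightarrow>
     (\<forall>x\<in>frontier \<Omega>. \<exists>r>0. \<exists>n g C. norm n = 1 \<and> C-lipschitz_on {y. n \<bullet> y = 0} g \<and>
        \<Omega> \<inter> ball x r = {z \<in> ball x r. g (z - (n \<bullet> z) *\<^sub>R n) < n \<bullet> z})"

text \<open>A polyhedral set need not be convex: it is a finite union of (convex) polytopes.\<close>

definition polyhedral_domain :: "'a::euclidean_space set \<Rightarrow> bool" where
  "polyhedral_domain \<Omega> \<longleftrightarrow>
     open \<Omega> \<and> bounded \<Omega> \<and>
     (\<exists>F. finite F \<and> (\<forall>P\<in>F. polytope P) \<and> closure \<Omega> = \<Union>F) \<and>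
     lipschitz_boundary \<Omega>"

text \<open>The \<open>(d-1)\<close>-dimensional Lebesgue measure of a set \<open>S\<close> contained in a hyperplane, as the
  \<open>d\<close>-dimensional measure of the right cylinder of height 1 over \<open>S\<close>. By the lemma
  \<open>hyperplane_measure_eq\<close> the choice of the unit normal does not matter, also if \<open>S\<close> lies in
  several hyperplanes. For sets not contained in a hyperplane the value is meaningless.\<close>

definition cylinder :: "'a::euclidean_space \<Rightarrow> 'a set \<Rightarrow> 'a set" where
  "cylinder n S = {x + t *\<^sub>R n |x t. x \<in> S \<and> 0 \<le> t \<and> t \<le> 1}"

definition hyperplane_measure :: "'a::euclidean_space set \<Rightarrow> real" where
  "hyperplane_measure S =
     measure lebesgue (cylinder (SOME n. norm n = 1 \<and> (\<exists>c. S \<subseteq> {x. n \<bullet> x = c})) S)"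

lemma cylinder_uminus:
  assumes "S \<subseteq> {x. n \<bullet> x = c}"
  shows "cylinder (- n) S = (+) (- n) ` cylinder n S"
proof (intro equalityI subsetI)
  fix z assume "z \<in> cylinder (- n) S"
  then obtain x t where *: "x \<in> S" "0 \<le> t" "t \<le> 1" "z = x + t *\<^sub>R (- n)"
    by (auto simp: cylinder_def)
  have "z = - n + (x + (1 - t) *\<^sub>R n)"
    using * by (simp add: algebra_simps)
  moreover have "x + (1 - t) *\<^sub>R n \<in> cylinder n S"
    unfolding cylinder_def using * by (intro CollectI exI[of _ x] exI[of _ "1 - t"]) auto
  ultimately show "z \<in> (+) (- n) ` cylinder n S" by blast
next
  fix z assume "z \<in> (+) (- n) ` cylinder n S"
  then obtain x t where *: "x \<in> S" "0 \<le> t" "t \<le> 1" "z = - n + (x + t *\<^sub>R n)"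
    by (auto simp: cylinder_def)
  have "z = x + (1 - t) *\<^sub>R (- n)"
    using * by (simp add: algebra_simps)
  then show "z \<in> cylinder (- n) S"
    unfolding cylinder_def using * by (intro CollectI exI[of _ x] exI[of _ "1 - t"]) auto
qed

lemma cylinder_negligible:
  assumes "norm n = 1" "norm m = 1" "m \<noteq> n" "m \<noteq> - n"
    and "S \<subseteq> {x. n \<bullet> x = c}" "S \<subseteq> {x. m \<bullet> x = e}"
  shows "negligible (cylinder n S)"
proof -
  define w where "w = m - (m \<bullet> n) *\<^sub>R n"
  have nn: "n \<bullet> n = 1" using assms(1) by (simp add: dot_square_norm)
  have "w \<noteq> 0"
  proof
    assume "w = 0"
    then have m: "m = (m \<bullet> n) *\<^sub>R n" by (simp add: w_def)
    then have "norm m = \<bar>m \<bullet> n\<bar>" using assms(1) by (metis norm_scaleR mult.right_neutral)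
    then have "m \<bullet> n = 1 \<or> m \<bullet> n = - 1" using assms(2) by linarith
    then show False using m assms(3,4) by auto
  qed
  moreover have "cylinder n S \<subseteq> {z. w \<bullet> z = e - (m \<bullet> n) * c}"
  proof
    fix z assume "z \<in> cylinder n S"
    then obtain x t where *: "x \<in> S" "z = x + t *\<^sub>R n"
      by (auto simp: cylinder_def)
    then have "n \<bullet> x = c" "m \<bullet> x = e" using assms(5,6) by auto
    then show "z \<in> {z. w \<bullet> z = e - (m \<bullet> n) * c}"
      using nn by (simp add: *(2) w_def inner_simps algebra_simps)
  qed
  ultimately show ?thesis
    by (intro negligible_subset[OF negligible_hyperplane[of w "e - (m \<bullet> n) * c"]]) auto
qed

lemma hyperplane_measure_eq:
  assumes "norm n = 1" and "S \<subseteq> {x. n \<bullet> x = c}"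
  shows "hyperplane_measure S = measure lebesgue (cylinder n S)"
proof -
  define m where "m = (SOME n. norm n = 1 \<and> (\<exists>c. S \<subseteq> {x. n \<bullet> x = c}))"
  have "norm m = 1 \<and> (\<exists>c. S \<subseteq> {x. m \<bullet> x = c})"
    unfolding m_def by (rule someI[of _ n]) (use assms in blast)
  then obtain e where m: "norm m = 1" "S \<subseteq> {x. m \<bullet> x = e}" by blast
  have hm: "hyperplane_measure S = measure lebesgue (cylinder m S)"
    by (simp add: hyperplane_measure_def m_def)
  consider "m = n" | "m = - n" | "m \<noteq> n" "m \<noteq> - n" by blast
  then show ?thesis
  proof cases
    case 2
    then show ?thesis
      by (simp only: hm cylinder_uminus[OF assms(2)] measure_translation)
  next
    case 3
    have "negligible (cylinder n S)"
      using cylinder_negligible[OF assms(1) m(1) 3 assms(2) m(2)] .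
    moreover have "negligible (cylinder m S)"
      using cylinder_negligible[OF m(1) assms(1) _ _ m(2) assms(2)] 3 by force
    ultimately show ?thesis
      by (simp add: hm negligible_imp_measure0)
  qed (simp add: hm)
qed

text \<open>A mesh consists of the control volumes \<open>K\<close>, the faces \<open>\<E>\<^sub>K\<close> of each control volume,
  and the points \<open>x\<^sub>K\<close>.\<close>

record 'a fv_mesh =
  cells :: "'a set set"
  cell_faces :: "'a set \<Rightarrow> 'a set set"
  center :: "'a set \<Rightarrow> 'a"

definition faces :: "'a fv_mesh \<Rightarrow> 'a set set" where
  "faces M = (\<Union>K\<in>cells M. cell_faces M K)"

text \<open>The relation \<open>\<sigma> = K|L\<close>.\<close>

definition interface :: "'a::euclidean_space fv_mesh \<Rightarrow> 'a set \<Rightarrow> 'a set \<Rightarrow> 'a set \<Rightarrow> bool" where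
  "interface M \<sigma> K L \<longleftrightarrow>
     K \<in> cells M \<and> L \<in> cells M \<and> K \<noteq> L \<and> \<sigma> \<in> faces M \<and> closure K \<inter> closure L = closure \<sigma>"

definition control_volume :: "'a::euclidean_space set \<Rightarrow> 'a set \<Rightarrow> bool" where
  "control_volume \<Omega> K \<longleftrightarrow>
     K \<subseteq> \<Omega> \<and> open K \<and> convex K \<and> polyhedron (closure K) \<and> measure lebesgue K > 0"

text \<open>The condition \<open>\<sigma> = rel_interior (closure \<sigma>)\<close> rules out pathological relatively open sets,
  such as dense open subsets of a face with arbitrarily small measure.\<close>

definition mesh_face :: "'a::euclidean_space set \<Rightarrow> bool" where
  "mesh_face \<sigma> \<longleftrightarrow>
     (\<exists>n c. n \<noteq> 0 \<and> openin (top_of_set {x. n \<bullet> x = c}) \<sigma>) \<and>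
     \<sigma> = rel_interior (closure \<sigma>) \<and> hyperplane_measure \<sigma> > 0"

definition admissible_mesh :: "'a::euclidean_space set \<Rightarrow> 'a fv_mesh \<Rightarrow> bool" where
  "admissible_mesh \<Omega> M \<longleftrightarrow>
     finite (cells M) \<and>
     (\<forall>K\<in>cells M. control_volume \<Omega> K) \<and>
     disjoint (cells M) \<and>
     (\<Union>K\<in>cells M. closure K) = closure \<Omega> \<and>
     (\<forall>\<sigma>\<in>faces M. mesh_face \<sigma>) \<and>
     (\<forall>K\<in>cells M. frontier K = (\<Union>\<sigma>\<in>cell_faces M K. closure \<sigma>)) \<and>
     (\<forall>K\<in>cells M. center M K \<in> closure K) \<and>
     (\<forall>K\<in>cells M. \<forall>L\<in>cells M. K \<noteq> L \<longrightarrow>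
        hyperplane_measure (closure K \<inter> closure L) = 0 \<or> (\<exists>\<sigma>. interface M \<sigma> K L)) \<and>
     (\<forall>K L \<sigma>. interface M \<sigma> K L \<longrightarrow>
        center M K \<noteq> center M L \<and>
        (\<forall>y\<in>\<sigma>. \<forall>z\<in>\<sigma>. orthogonal (center M L - center M K) (y - z))) \<and>
     (\<forall>K\<in>cells M. \<forall>\<sigma>\<in>cell_faces M K. \<sigma> \<subseteq> frontier \<Omega> \<and> center M K \<notin> \<sigma> \<longrightarrow>
        (\<exists>y\<in>\<sigma>. \<forall>z\<in>\<sigma>. \<forall>w\<in>\<sigma>. orthogonal (y - center M K) (z - w)))"

definition regular_mesh :: "real \<Rightarrow> 'a::euclidean_space fv_mesh \<Rightarrow> bool" where
  "regular_mesh \<xi> M \<longleftrightarrow>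
     (\<forall>K L \<sigma>. interface M \<sigma> K L \<longrightarrow>
        infdist (center M K) \<sigma> \<ge> \<xi> * dist (center M K) (center M L))"

text \<open>\<open>\<tau>\<^sub>\<sigma>\<close> for \<open>\<sigma> = K|L\<close>.\<close>

definition transmissibility :: "'a::euclidean_space fv_mesh \<Rightarrow> 'a set \<Rightarrow> 'a set \<Rightarrow> 'a set \<Rightarrow> real" where
  "transmissibility M \<sigma> K L = hyperplane_measure \<sigma> / dist (center M K) (center M L)"

text \<open>An element of \<open>X(\<T>)\<close> is represented by its values on the cells; \<open>step_fun\<close> is the
  corresponding function, with the value 0 on the null set of points of the domain
  that lie in no cell.\<close>

definition step_fun :: "'a fv_mesh \<Rightarrow> ('a set \<Rightarrow> real) \<Rightarrow> 'a \<Rightarrow> real" where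
  "step_fun M v x = (\<Sum>K\<in>cells M. v K * indicator K x)"

definition L2_norm_on :: "'a::euclidean_space set \<Rightarrow> ('a \<Rightarrow> real) \<Rightarrow> real" where
  "L2_norm_on \<Omega> f = sqrt (LINT x:\<Omega>|lebesgue. (f x)\<^sup>2)"

text \<open>Every interior face occurs twice in the sum, as \<open>K|L\<close> and as \<open>L|K\<close>; hence the
  factor \<open>1/2\<close>.\<close>

definition discrete_H1_seminorm :: "'a::euclidean_space fv_mesh \<Rightarrow> ('a set \<Rightarrow> real) \<Rightarrow> real" where
  "discrete_H1_seminorm M v =
     sqrt (1/2 * (\<Sum>(\<sigma>, K, L) \<in> {(\<sigma>, K, L). interface M \<sigma> K L}.
                    transmissibility M \<sigma> K L * \<bar>v K - v L\<bar>\<^sup>2))"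

text \<open>Validity of \<open>C\<close>, uniformly in the mesh, in the discrete Poincare-Wirtinger inequality
  on a domain of measure 1.\<close>

definition poincare_wirtinger_constant :: "'a::euclidean_space set \<Rightarrow> real \<Rightarrow> bool" where
  "poincare_wirtinger_constant \<Omega> C \<longleftrightarrow>
     C > 0 \<and>
     (\<forall>M \<xi> v. admissible_mesh \<Omega> M \<and> \<xi> > 0 \<and> regular_mesh \<xi> M \<longrightarrow>
        L2_norm_on \<Omega> (\<lambda>x. step_fun M v x - (LINT y:\<Omega>|lebesgue. step_fun M v y))
          \<le> C * \<xi> powr (- 1/2) * discrete_H1_seminorm M v)"

text \<open>In the sum over \<open>(\<sigma>, L)\<close>, \<open>\<sigma>\<close> runs through the interior faces of \<open>K\<close> and \<open>L\<close> is the cell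
  with \<open>\<sigma> = K|L\<close>.\<close>

definition fv_scheme ::
  "'a::euclidean_space fv_mesh \<Rightarrow> real \<Rightarrow> real \<Rightarrow> (nat \<Rightarrow> 'a set \<Rightarrow> real) \<Rightarrow> bool" where
  "fv_scheme M \<beta> dt u \<longleftrightarrow>
     (\<forall>k. \<forall>K\<in>cells M.
        measure lebesgue K * ((u (Suc k) K - u k K) / dt)
        + (\<Sum>(\<sigma>, L) \<in> {(\<sigma>, L). interface M \<sigma> K L}.
             transmissibility M \<sigma> K L * (u (Suc k) K powr \<beta> - u (Suc k) L powr \<beta>)) = 0)"

definition discrete_entropy :: "'a::euclidean_space fv_mesh \<Rightarrow> real \<Rightarrow> ('a set \<Rightarrow> real) \<Rightarrow> real" where
  "discrete_entropy M \<alpha> v =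
     1 / (\<alpha> + 1) * ((\<Sum>K\<in>cells M. measure lebesgue K * v K powr (\<alpha> + 1))
       - (\<Sum>K\<in>cells M. measure lebesgue K * v K) powr (\<alpha> + 1))"

definition beckner_constant :: "real \<Rightarrow> real \<Rightarrow> real \<Rightarrow> real \<Rightarrow> real" where
  "beckner_constant C\<^sub>p \<xi> p q = 2 * (p * q - 1) * C\<^sub>p powr q / ((2 - q) * \<xi> powr (q / 2))"

end

theory Submission
  imports Defs
begin

text \<open>
  Multiplying the scheme by \<open>(u\<^sub>K)\<^sup>\<alpha>\<close> at the new time level and summing by parts, convexity
  of \<open>x\<^sup>\<alpha>\<^sup>+\<^sup>1\<close>, conservation of mass and
  \<open>(x\<^sup>\<alpha> - y\<^sup>\<alpha>) (x\<^sup>\<beta> - y\<^sup>\<beta>) \<ge> 4\<alpha>\<beta>/(\<alpha>+\<beta>)\<^sup>2 (x\<^sup>p - y\<^sup>p)\<^sup>2\<close> show that the entropy decreases in each step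
  by at least a multiple of the squared discrete seminorm of \<open>u\<^sup>p\<close>. A discrete Beckner inequality
  bounds this seminorm from below by a power of the entropy, with an exponent \<open>2/q > 1\<close>, and
  the resulting implicit recursion \<open>e' + A h e'\<^sup>\<gamma> \<le> e\<close>, \<open>\<gamma> = 2/q\<close>, decays algebraically.

  For the Beckner inequality, interpolation of the \<open>q\<close>-norm between the exponents \<open>1/p\<close> and \<open>2\<close>
  gives \<open>\<parallel>f\<parallel>\<^sub>q\<^sup>q - \<parallel>f\<parallel>\<^bsub>1/p\<^esub>\<^sup>q \<le> 2(pq-1)/(2-q) (\<parallel>f\<parallel>\<^sub>2\<^sup>q - \<parallel>f\<parallel>\<^sub>q\<^sup>q)\<close>, and \<open>\<parallel>f\<parallel>\<^sub>2\<^sup>q - \<parallel>f\<parallel>\<^sub>q\<^sup>q\<close>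
  is at most the \<open>q\<close>-th power of the standard deviation of \<open>f\<close>, to which the discrete
  Poincare-Wirtinger inequality applies.\<close>

section \<open>Convexity inequalities for real powers and weighted sums\<close>

lemma weighted_am_gm:
  fixes a b :: real
  assumes "0 \<le> t" "t \<le> 1" "0 \<le> a" "0 \<le> b"
  shows "a powr t * b powr (1 - t) \<le> t * a + (1 - t) * b"
proof (cases "a = 0 \<or> b = 0")
  case True
  \<comment> \<open>The left side is 0 here, since \<open>0 powr t = 0\<close> even for
    \<open>t = 0\<close>.\<close>
  then show ?thesis using assms by auto
next
  case False
  then show ?thesis using Youngs_inequality_0[of t "1 - t" a b] assms by simp
qed

text \<open>Young's inequality for \<open>x powr r\<close> and \<open>s powr r\<close> with weight
  \<open>1 / r\<close> rearranges to the tangent inequality at \<open>s\<close>; no derivative is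
  taken, so \<open>s = 0\<close> and \<open>x = 0\<close> are covered.\<close>

lemma powr_ge_tangent:
  fixes s x r :: real
  assumes "1 \<le> r" "0 \<le> s" "0 \<le> x"
  shows "s powr r + r * s powr (r - 1) * (x - s) \<le> x powr r"
proof -
  have "(x powr r) powr (1 / r) * (s powr r) powr (1 - 1 / r) \<le> (1 / r) * x powr r + (1 - 1 / r) * s powr r"
    using assms by (intro weighted_am_gm) auto
  moreover have "(x powr r) powr (1 / r) = x"
    using assms by (simp add: powr_powr)
  moreover have "(s powr r) powr (1 - 1 / r) = s powr (r - 1)"
    using assms by (simp add: powr_powr right_diff_distrib)
  ultimately have "r * (x * s powr (r - 1)) \<le> r * ((1 / r) * x powr r + (1 - 1 / r) * s powr r)"
    using assms by (intro mult_left_mono) auto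
  also have "\<dots> = x powr r + (r - 1) * s powr r"
    using assms by (simp add: field_simps)
  finally have *: "r * (x * s powr (r - 1)) \<le> x powr r + (r - 1) * s powr r" .
  have "s powr (r - 1) * s = s powr r"
    using assms by (cases "s = 0") (auto simp: powr_diff)
  moreover have "r * s powr (r - 1) * (x - s) = r * (x * s powr (r - 1)) - r * (s powr (r - 1) * s)"
    by (simp add: algebra_simps)
  ultimately show ?thesis using * by (simp add: left_diff_distrib)
qed

text \<open>Jensen's inequality: when the tangent inequality at the mean \<open>s\<close> is
  averaged, the linear term drops out because the weights sum to 1.\<close>

lemma powr_sum_le_sum_powr:
  fixes w f :: "'i \<Rightarrow> real"
  assumes "finite I" "\<And>i. i \<in> I \<Longrightarrow> 0 \<le> w i" "(\<Sum>i\<in>I. w i) = 1"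
    and "\<And>i. i \<in> I \<Longrightarrow> 0 \<le> f i" and "1 \<le> r"
  shows "(\<Sum>i\<in>I. w i * f i) powr r \<le> (\<Sum>i\<in>I. w i * f i powr r)"
proof -
  define s where "s = (\<Sum>i\<in>I. w i * f i)"
  have s: "0 \<le> s" unfolding s_def using assms by (intro sum_nonneg) auto
  have "s powr r = (\<Sum>i\<in>I. w i) * (s powr r - r * s powr (r - 1) * s) + r * s powr (r - 1) * s"
    using assms by simp
  also have "\<dots> = (\<Sum>i\<in>I. w i * (s powr r - r * s powr (r - 1) * s) + r * s powr (r - 1) * (w i * f i))"
    by (simp add: sum.distrib flip: s_def sum_distrib_left sum_distrib_right)
  also have "\<dots> = (\<Sum>i\<in>I. w i * (s powr r + r * s powr (r - 1) * (f i - s)))"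
    by (intro sum.cong) (auto simp: algebra_simps)
  also have "\<dots> \<le> (\<Sum>i\<in>I. w i * f i powr r)"
    using assms s by (intro sum_mono mult_left_mono powr_ge_tangent) auto
  finally show ?thesis by (simp add: s_def)
qed

text \<open>Hoelder's inequality, i.e. log-convexity of the moments in the exponent. After division
  by the right side, Young's inequality applies to each term and the bounds add up to 1.\<close>

lemma sum_powr_interpolation:
  fixes w f :: "'i \<Rightarrow> real"
  assumes "finite I" "\<And>i. i \<in> I \<Longrightarrow> 0 \<le> w i" "\<And>i. i \<in> I \<Longrightarrow> 0 \<le> f i"
    and t: "0 \<le> t" "t \<le> 1"
  shows "(\<Sum>i\<in>I. w i * f i powr (t * a + (1 - t) * b)) \<le>
    (\<Sum>i\<in>I. w i * f i powr a) powr t * (\<Sum>i\<in>I. w i * f i powr b) powr (1 - t)"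
    (is "?Z \<le> ?X powr t * ?Y powr (1 - t)")
proof (cases "\<exists>i\<in>I. w i * f i \<noteq> 0")
  case True
  then obtain j where j: "j \<in> I" "w j > 0" "f j > 0"
    using assms by (metis less_eq_real_def mult_zero_left mult_zero_right)
  have pos: "(\<Sum>i\<in>I. w i * f i powr c) > 0" for c
    using assms j by (intro sum_pos2[of I j]) auto
  let ?C = "?X powr t * ?Y powr (1 - t)"
  have C: "?C > 0" using pos[of a] pos[of b] by simp
  have "?Z / ?C = (\<Sum>i\<in>I. w i * ((f i powr a / ?X) powr t * (f i powr b / ?Y) powr (1 - t)))"
    using pos[of a] pos[of b] unfolding sum_divide_distrib
    by (intro sum.cong) (auto simp: powr_divide powr_powr powr_add mult.commute)
  also have "\<dots> \<le> (\<Sum>i\<in>I. w i * (t * (f i powr a / ?X) + (1 - t) * (f i powr b / ?Y)))"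
    using assms pos[of a] pos[of b]
    by (intro sum_mono mult_left_mono weighted_am_gm) auto
  also have "\<dots> = t / ?X * ?X + (1 - t) / ?Y * ?Y"
    unfolding sum_distrib_left sum.distrib[symmetric]
    by (intro sum.cong) (auto simp: algebra_simps)
  also have "\<dots> = 1" using pos[of a] pos[of b] by simp
  finally show ?thesis using C by (simp add: divide_le_eq)
next
  case False
  \<comment> \<open>Each \<open>i\<close> has \<open>w i = 0\<close> or \<open>f i = 0\<close>, and
    \<open>0 powr c = 0\<close> for every \<open>c\<close>.\<close>
  then have "?Z = 0" by (intro sum.neutral) auto
  then show ?thesis by simp
qed

section \<open>Beckner inequality for finite weighted sums\<close>

text \<open>On [0, 1] a power with exponent at most 1 dominates its base. Below, \<open>a\<close>
  and \<open>1 - a\<close> are the shares of the second moment due to the squared mean and to the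
  variance.\<close>

lemma one_le_powr_add_powr:
  fixes a s t :: real
  assumes "0 \<le> a" "a \<le> 1" "0 \<le> s" "s \<le> 1" "0 \<le> t" "t \<le> 1"
  shows "1 \<le> a powr s + (1 - a) powr t"
proof -
  have "a powr 1 \<le> a powr s" "(1 - a) powr 1 \<le> (1 - a) powr t"
    using assms by (intro powr_mono'; simp)+
  then show ?thesis using assms by simp
qed

text \<open>The second moment \<open>D\<close> is the squared mean plus the variance. With
  \<open>a = m\<^sup>2 / D\<close>, multiply \<open>1 \<le> a powr s + (1 - a) powr (q / 2)\<close>
  by \<open>D powr (q / 2)\<close>: the last term becomes the power of the variance, and it remains
  to choose \<open>s\<close> so that the other one is at most \<open>B\<close>.\<close>

lemma norm_diff_le_variance:
  fixes w f :: "'i \<Rightarrow> real"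
  assumes "finite I" "\<And>i. i \<in> I \<Longrightarrow> 0 \<le> w i" "(\<Sum>i\<in>I. w i) = 1"
    and f: "\<And>i. i \<in> I \<Longrightarrow> 0 \<le> f i" and q: "0 < q" "q < 2"
  shows "(\<Sum>i\<in>I. w i * (f i)\<^sup>2) powr (q / 2) - (\<Sum>i\<in>I. w i * f i powr q) \<le>
    (\<Sum>i\<in>I. w i * (f i - (\<Sum>j\<in>I. w j * f j))\<^sup>2) powr (q / 2)"
proof -
  define m where "m = (\<Sum>i\<in>I. w i * f i)"
  define D where "D = (\<Sum>i\<in>I. w i * (f i)\<^sup>2)"
  define B where "B = (\<Sum>i\<in>I. w i * f i powr q)"
  have "(\<Sum>i\<in>I. w i * (f i - m)\<^sup>2) = D - 2 * m * m + (\<Sum>i\<in>I. w i) * m\<^sup>2"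
    unfolding D_def by (simp add: m_def sum_distrib_left sum_distrib_right sum.distrib
      sum_subtractf power2_diff algebra_simps)
  then have var: "(\<Sum>i\<in>I. w i * (f i - m)\<^sup>2) = D - m\<^sup>2"
    using assms(3) by (simp add: power2_eq_square)
  have "0 \<le> (\<Sum>i\<in>I. w i * (f i - m)\<^sup>2)"
    using assms by (intro sum_nonneg) auto
  then have mD: "m\<^sup>2 \<le> D" using var by simp
  have m: "0 \<le> m" and B: "0 \<le> B" unfolding m_def B_def using assms by (auto intro!: sum_nonneg)
  have D2: "D = (\<Sum>i\<in>I. w i * f i powr 2)"
    unfolding D_def using f by (intro sum.cong) auto
  have "D powr (q / 2) - B \<le> (D - m\<^sup>2) powr (q / 2)"
  proof (cases "D = 0")
    case True
    then show ?thesis using B by (smt (verit) powr_ge_zero powr_zero_eq_one powr_0)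
  next
    case False
    then have D: "D > 0" using mD by (smt (verit) zero_le_power2)
    define a where "a = m\<^sup>2 / D"
    have a: "0 \<le> a" "a \<le> 1" using mD D by (auto simp: a_def)
    \<comment> \<open>For \<open>q \<ge> 1\<close> Jensen's inequality bounds the mean by the \<open>q\<close>-norm; for \<open>q < 1\<close> it fails and the
      mean is interpolated between the exponents \<open>q\<close> and 2.\<close>
    have "\<exists>s. 0 \<le> s \<and> s \<le> 1 \<and> a powr s * D powr (q / 2) \<le> B"
    proof (cases "1 \<le> q")
      case True
      have "a powr (q / 2) * D powr (q / 2) = m\<^sup>2 powr (q / 2)"
        using D by (simp add: a_def powr_divide)
      also have "\<dots> = m powr q" using m
        by (simp add: powr_powr flip: powr_numeral)
      also have "\<dots> \<le> B" unfolding m_def B_def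
        using assms True by (intro powr_sum_le_sum_powr) auto
      finally show ?thesis using q by (intro exI[of _ "q / 2"]) auto
    next
      case False
      \<comment> \<open>This \<open>t\<close> makes the interpolated exponent 1, which is the mean;
        raising the resulting bound to the power \<open>2 - q\<close> then turns the exponent of
        \<open>B\<close> into 1.\<close>
      define t where "t = 1 / (2 - q)"
      have t1: "t * (2 - q) = 1" using q by (simp add: t_def)
      have t: "0 \<le> t" "t \<le> 1" "t * q + (1 - t) * 2 = 1"
      proof -
        show "0 \<le> t" "t \<le> 1" using False q by (simp_all add: t_def)
        show "t * q + (1 - t) * 2 = 1" using t1 by (simp add: algebra_simps)
      qed
      have "m = (\<Sum>i\<in>I. w i * f i powr (t * q + (1 - t) * 2))"
        unfolding m_def t(3) using f by (intro sum.cong) auto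
      also have "\<dots> \<le> B powr t * D powr (1 - t)"
        unfolding B_def D2 using assms t by (intro sum_powr_interpolation) auto
      finally have "m powr (2 - q) \<le> (B powr t * D powr (1 - t)) powr (2 - q)"
        using m q by (intro powr_mono2) auto
      also have "\<dots> = B powr (t * (2 - q)) * D powr ((1 - t) * (2 - q))"
        using B D by (simp add: powr_mult powr_powr)
      also have "\<dots> = B * D powr (1 - q)"
        using t1 B by (simp add: left_diff_distrib)
      finally have mq: "m powr (2 - q) \<le> B * D powr (1 - q)" .
      have "a powr (1 - q / 2) = m powr (2 - q) * D powr (q / 2 - 1)"
        using m D by (simp add: a_def powr_divide powr_powr algebra_simps powr_minus_divide
            flip: powr_numeral) (simp add: powr_diff)
      then have "a powr (1 - q / 2) * D powr (q / 2) = m powr (2 - q) * D powr (q - 1)"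
        by (simp flip: powr_add)
      also have "\<dots> \<le> B * D powr (1 - q) * D powr (q - 1)"
        using mq by (intro mult_right_mono) auto
      also have "\<dots> = B"
        using D by (simp add: mult.assoc flip: powr_add)
      finally show ?thesis using q by (intro exI[of _ "1 - q / 2"]) auto
    qed
    then obtain s where s: "0 \<le> s" "s \<le> 1" "a powr s * D powr (q / 2) \<le> B" by blast
    have "1 \<le> a powr s + (1 - a) powr (q / 2)"
      using a s q by (intro one_le_powr_add_powr) auto
    then have "1 * D powr (q / 2) \<le> (a powr s + (1 - a) powr (q / 2)) * D powr (q / 2)"
      by (intro mult_right_mono) auto
    also have "\<dots> = a powr s * D powr (q / 2) + ((1 - a) * D) powr (q / 2)"
      using a D by (simp add: distrib_right powr_mult)
    also have "(1 - a) * D = D - m\<^sup>2" using D by (simp add: a_def field_simps)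
    finally show ?thesis using s by simp
  qed
  then show ?thesis by (simp add: var[unfolded m_def] D_def B_def m_def)
qed

text \<open>Interpolation gives only a multiplicative bound on \<open>B\<close> by powers of
  \<open>A\<close> and \<open>D\<close>. Taking logarithms and using \<open>ln z \<le> z - 1\<close>
  makes it additive, with the factor \<open>\<kappa>\<close>; the variance estimate then replaces
  \<open>D powr (q / 2) - B\<close>.\<close>

lemma weighted_beckner_inequality:
  fixes w f :: "'i \<Rightarrow> real"
  assumes "finite I" "\<And>i. i \<in> I \<Longrightarrow> 0 \<le> w i" "(\<Sum>i\<in>I. w i) = 1"
    and f: "\<And>i. i \<in> I \<Longrightarrow> 0 \<le> f i" and q: "0 < q" "q < 2" and p: "0 < p" "1 \<le> p * q"
  shows "(\<Sum>i\<in>I. w i * f i powr q) - (\<Sum>i\<in>I. w i * f i powr (1 / p)) powr (p * q) \<le>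
    2 * (p * q - 1) / (2 - q) * (\<Sum>i\<in>I. w i * (f i - (\<Sum>j\<in>I. w j * f j))\<^sup>2) powr (q / 2)"
proof -
  define A where "A = (\<Sum>i\<in>I. w i * f i powr (1 / p))"
  define D where "D = (\<Sum>i\<in>I. w i * (f i)\<^sup>2)"
  define B where "B = (\<Sum>i\<in>I. w i * f i powr q)"
  define \<kappa> where "\<kappa> = 2 * (p * q - 1) / (2 - q)"
  define V where "V = (\<Sum>i\<in>I. w i * (f i - (\<Sum>j\<in>I. w j * f j))\<^sup>2) powr (q / 2)"
  have k: "0 \<le> \<kappa>" using p q by (simp add: \<kappa>_def)
  have D2: "D = (\<Sum>i\<in>I. w i * f i powr 2)"
    unfolding D_def using f by (intro sum.cong) auto
  have ex: "D powr (q / 2) - B \<le> V"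
    unfolding D_def B_def V_def using assms by (intro norm_diff_le_variance) auto
  have "B - A powr (p * q) \<le> \<kappa> * (D powr (q / 2) - B) \<or> (B = 0 \<and> A powr (p * q) = 0)"
  proof (cases "\<exists>i\<in>I. w i * f i \<noteq> 0")
    case True
    then obtain j where j: "j \<in> I" "w j > 0" "f j > 0"
      using assms by (metis less_eq_real_def mult_zero_left mult_zero_right)
    have pos: "(\<Sum>i\<in>I. w i * f i powr c) > 0" for c
      using assms j by (intro sum_pos2[of I j]) auto
    have pos: "A > 0" "B > 0" "D > 0"
      using pos by (auto simp: A_def B_def D2)
    \<comment> \<open>From \<open>q < 2\<close> and \<open>1 \<le> p * q\<close> one gets
      \<open>1 / p < 2\<close>, so \<open>q\<close> lies between the exponents \<open>1 / p\<close>
      and 2.\<close>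
    have p2: "2 * p - 1 > 0"
      using p mult_strict_left_mono[OF q(2) p(1)] by simp
    \<comment> \<open>The solution of \<open>t / p + 2 * (1 - t) = q\<close>.\<close>
    define t where "t = p * (2 - q) / (2 * p - 1)"
    have t1: "1 - t = (p * q - 1) / (2 * p - 1)" using p2 by (simp add: t_def field_simps)
    have "0 \<le> 1 - t" unfolding t1 using p p2 by simp
    then have t: "0 \<le> t" "t \<le> 1" using p2 p q by (auto simp: t_def)
    have "t * (1 / p) + (1 - t) * 2 = q"
      unfolding t1 using p p2 by (simp add: t_def divide_simps) (simp add: algebra_simps)
    then have "B \<le> A powr t * D powr (1 - t)"
      using sum_powr_interpolation[of I w f t "1 / p" 2] assms t by (simp add: A_def B_def D2)
    then have "ln B \<le> ln (A powr t * D powr (1 - t))"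
      using pos by simp
    also have "\<dots> = t * ln A + (1 - t) * ln D"
      using pos by (simp add: ln_mult ln_powr)
    finally have lnB: "ln B \<le> t * ln A + (1 - t) * ln D" .
    \<comment> \<open>In terms of this ratio the logarithmic bound becomes
      \<open>ln B - \<kappa> * ln z \<le> p * q * ln A\<close>.\<close>
    define z where "z = D powr (q / 2) / B"
    have z: "z > 0" "ln z = q / 2 * ln D - ln B"
      using pos by (auto simp: z_def ln_div ln_powr)
    have "(2 * p - 1) * ln B \<le> (2 * p - 1) * (t * ln A + (1 - t) * ln D)"
      using lnB p2 by (intro mult_left_mono) auto
    also have "\<dots> = ((2 * p - 1) * t) * ln A + ((2 * p - 1) * (1 - t)) * ln D"
      by (simp add: algebra_simps)
    also have "\<dots> = p * (2 - q) * ln A + (p * q - 1) * ln D"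
      unfolding t1 using p2 by (simp add: t_def)
    finally have "q * ((2 * p - 1) * ln B) \<le> q * (p * (2 - q) * ln A + (p * q - 1) * ln D)"
      using q by (intro mult_left_mono) auto
    then have "(2 - q) * ln B - 2 * (p * q - 1) * ln z \<le> (2 - q) * (p * q * ln A)"
      unfolding z(2) by (simp add: algebra_simps)
    then have *: "((2 - q) * ln B - 2 * (p * q - 1) * ln z) / (2 - q) \<le> p * q * ln A"
      using q by (simp add: divide_le_eq mult.commute)
    have lnA: "ln B - \<kappa> * ln z \<le> p * q * ln A"
    proof -
      have "((2 - q) * ln B - 2 * (p * q - 1) * ln z) / (2 - q) = ln B - \<kappa> * ln z"
        using q by (simp add: \<kappa>_def divide_simps)
      then show ?thesis using * by simp
    qed
    have "B - \<kappa> * (D powr (q / 2) - B) = B * (1 - \<kappa> * (z - 1))"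
      using pos by (simp add: z_def field_simps)
    also have "\<dots> \<le> B * (1 + (- \<kappa> * ln z))"
      using pos mult_left_mono[OF ln_le_minus_one[OF z(1)] k] by (intro mult_left_mono) auto
    also have "\<dots> \<le> B * exp (- \<kappa> * ln z)"
      using pos by (intro mult_left_mono exp_ge_add_one_self) auto
    also have "\<dots> = exp (ln B - \<kappa> * ln z)"
      using pos by (simp add: exp_diff exp_minus field_simps)
    also have "\<dots> \<le> exp (p * q * ln A)"
      using lnA by simp
    also have "\<dots> = A powr (p * q)"
      using pos by (simp add: powr_def)
    finally show ?thesis by simp
  next
    case False
    then have "B = 0" "A = 0" unfolding A_def B_def by (auto intro!: sum.neutral)
    then show ?thesis by simp
  qed
  moreover have "\<kappa> * (D powr (q / 2) - B) \<le> \<kappa> * V"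
    using ex k by (rule mult_left_mono)
  moreover have "0 \<le> \<kappa> * V" using k by (simp add: V_def)
  ultimately show ?thesis unfolding A_def B_def \<kappa>_def V_def by linarith
qed

section \<open>Lower bound for products of differences of powers\<close>

text \<open>With \<open>x = exp (S + D)\<close> and \<open>y = exp (S - D)\<close> differences of powers become hyperbolic sines, and the
  lower bound for the product of two such differences below reduces to
  \<open>\<bar>sinh (t r)\<bar> \<le> \<bar>t sinh r\<bar>\<close> with \<open>t = (\<alpha> - \<beta>)/(\<alpha> + \<beta>)\<close>.\<close>

lemma sinh_mult_le:
  fixes t r :: real
  assumes "0 \<le> t" "t \<le> 1" "0 \<le> r"
  shows "sinh (t * r) \<le> t * sinh r"
proof -
  have "(\<lambda>x. t * sinh x - sinh (t * x)) 0 \<le> (\<lambda>x. t * sinh x - sinh (t * x)) r"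
  proof (rule DERIV_nonneg_imp_nondecreasing[OF \<open>0 \<le> r\<close>])
    fix x :: real assume "0 \<le> x" "x \<le> r"
    then have "cosh (t * x) \<le> cosh x"
      using assms by (simp add: cosh_real_nonneg_le_iff mult_left_le_one_le)
    then show "\<exists>y. ((\<lambda>x. t * sinh x - sinh (t * x)) has_real_derivative y) (at x) \<and> 0 \<le> y"
      using assms by (intro exI[of _ "t * cosh x - t * cosh (t * x)"])
        (auto intro!: derivative_eq_intros mult_left_mono)
  qed
  then show ?thesis by simp
qed

lemma sinh_mult_square_le:
  fixes t r :: real
  assumes "\<bar>t\<bar> \<le> 1"
  shows "(sinh (t * r))\<^sup>2 \<le> t\<^sup>2 * (sinh r)\<^sup>2"
proof -
  have "\<bar>sinh (t * r)\<bar> \<le> \<bar>t * sinh r\<bar>"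
    using sinh_mult_le[of "\<bar>t\<bar>" "\<bar>r\<bar>"] assms by (simp flip: abs_mult)
  then have "(sinh (t * r))\<^sup>2 \<le> (t * sinh r)\<^sup>2"
    by (simp add: abs_le_square_iff)
  then show ?thesis by (simp add: power_mult_distrib)
qed

lemma sinh_add_mult_sinh_diff:
  fixes a b :: real
  shows "sinh (a + b) * sinh (a - b) = (sinh a)\<^sup>2 - (sinh b)\<^sup>2"
proof -
  have "sinh (a + b) * sinh (a - b) = (sinh a)\<^sup>2 * (cosh b)\<^sup>2 - (cosh a)\<^sup>2 * (sinh b)\<^sup>2"
    unfolding sinh_add sinh_diff by (simp add: power2_eq_square algebra_simps)
  then show ?thesis unfolding cosh_square_eq by (simp add: algebra_simps)
qed

lemma powr_diff_mult_powr_diff_ge: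
  fixes x y \<alpha> \<beta> :: real
  assumes xy: "0 \<le> x" "0 \<le> y" and ab: "0 < \<alpha>" "0 < \<beta>"
  shows "4 * \<alpha> * \<beta> / (\<alpha> + \<beta>)\<^sup>2 * (x powr ((\<alpha> + \<beta>) / 2) - y powr ((\<alpha> + \<beta>) / 2))\<^sup>2 \<le>
    (x powr \<alpha> - y powr \<alpha>) * (x powr \<beta> - y powr \<beta>)"
proof -
  have "0 \<le> (\<alpha> - \<beta>)\<^sup>2" by simp
  then have "4 * \<alpha> * \<beta> \<le> (\<alpha> + \<beta>)\<^sup>2" by (simp add: power2_eq_square algebra_simps)
  then have c: "4 * \<alpha> * \<beta> / (\<alpha> + \<beta>)\<^sup>2 \<le> 1" using ab by simp
  have sq: "(z powr ((\<alpha> + \<beta>) / 2))\<^sup>2 = z powr \<alpha> * z powr \<beta>" for z :: real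
    by (simp add: power2_eq_square flip: powr_add)
  show ?thesis
  proof (cases "x = 0 \<or> y = 0")
    \<comment> \<open>With one argument 0 the square equals the product on the right, so it is
      enough that the constant is at most 1.\<close>
    case True
    then have "(x powr ((\<alpha> + \<beta>) / 2) - y powr ((\<alpha> + \<beta>) / 2))\<^sup>2 =
        (x powr \<alpha> - y powr \<alpha>) * (x powr \<beta> - y powr \<beta>)" (is "?l = ?r")
      by (auto simp: sq)
    moreover have "4 * \<alpha> * \<beta> / (\<alpha> + \<beta>)\<^sup>2 * ?l \<le> ?l"
      using c ab by (intro mult_left_le_one_le) auto
    ultimately show ?thesis by simp
  next
    case False
    define r where "r = (\<alpha> + \<beta>) / 2 * ((ln x - ln y) / 2)"
    define S where "S = (ln x + ln y) / 2"
    define t where "t = (\<alpha> - \<beta>) / (\<alpha> + \<beta>)"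
    have diff: "x powr z - y powr z = 2 * (exp (z * S) * sinh (z * ((ln x - ln y) / 2)))" for z
      using False xy unfolding sinh_def S_def
      by (simp add: powr_def right_diff_distrib flip: exp_add) (simp add: field_simps)
    \<comment> \<open>Since \<open>\<alpha>\<close> and \<open>\<beta>\<close> are
      \<open>(\<alpha> + \<beta>) / 2\<close> times \<open>1 + t\<close> and \<open>1 - t\<close>,
      the product on the right involves \<open>sinh (r + t * r) * sinh (r - t * r)\<close>, a
      difference of squares. The constant of the lemma is \<open>1 - t\<^sup>2\<close>.\<close>
    have t: "\<bar>t\<bar> \<le> 1" "\<alpha> * ((ln x - ln y) / 2) = r + t * r" "\<beta> * ((ln x - ln y) / 2) = r - t * r"
      using ab by (auto simp: t_def r_def field_simps)
    have t2: "1 - t\<^sup>2 = 4 * \<alpha> * \<beta> / (\<alpha> + \<beta>)\<^sup>2"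
    proof -
      have "(\<alpha> + \<beta>)\<^sup>2 - (\<alpha> - \<beta>)\<^sup>2 = 4 * \<alpha> * \<beta>"
        by (simp add: power2_eq_square algebra_simps)
      moreover have "1 - t\<^sup>2 = ((\<alpha> + \<beta>)\<^sup>2 - (\<alpha> - \<beta>)\<^sup>2) / (\<alpha> + \<beta>)\<^sup>2"
        unfolding t_def power_divide diff_divide_distrib[of "(\<alpha> + \<beta>)\<^sup>2"] using ab by simp
      ultimately show ?thesis by simp
    qed
    have "4 * \<alpha> * \<beta> / (\<alpha> + \<beta>)\<^sup>2 * (x powr ((\<alpha> + \<beta>) / 2) - y powr ((\<alpha> + \<beta>) / 2))\<^sup>2
      = 4 * (exp ((\<alpha> + \<beta>) / 2 * S))\<^sup>2 * ((1 - t\<^sup>2) * (sinh r)\<^sup>2)"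
      unfolding diff t2[symmetric] by (simp add: power_mult_distrib r_def)
    also have "\<dots> \<le> 4 * (exp ((\<alpha> + \<beta>) / 2 * S))\<^sup>2 * ((sinh r)\<^sup>2 - (sinh (t * r))\<^sup>2)"
      using sinh_mult_square_le[OF t(1), of r]
      by (intro mult_left_mono) (auto simp: algebra_simps)
    also have "(exp ((\<alpha> + \<beta>) / 2 * S))\<^sup>2 = exp (\<alpha> * S) * exp (\<beta> * S)"
      by (simp add: power2_eq_square algebra_simps flip: exp_add)
    also have "(sinh r)\<^sup>2 - (sinh (t * r))\<^sup>2 = sinh (\<alpha> * ((ln x - ln y) / 2)) * sinh (\<beta> * ((ln x - ln y) / 2))"
      unfolding t by (rule sinh_add_mult_sinh_diff[symmetric])
    finally show ?thesis unfolding diff by (simp add: mult_ac)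
  qed
qed

section \<open>Algebraic decay of the implicit recursion\<close>

text \<open>The hypothesis reads \<open>y * (1 + s) \<le> x\<close>, and taking the negative power
  \<open>1 - \<gamma>\<close> reverses it. Bernoulli's inequality for
  \<open>(1 + s) powr \<gamma>\<close> then leaves a gain that depends on \<open>y\<close>; the
  upper bound \<open>z\<close> makes it uniform, so that gains of successive steps can be
  added.\<close>

lemma entropy_recursion_step:
  fixes x y A h \<gamma> :: real
  assumes "0 < y" "0 < A" "0 < h" "1 < \<gamma>" and le: "y + A * h * y powr \<gamma> \<le> x" and "y \<le> z"
  shows "x powr (1 - \<gamma>) + h * ((\<gamma> - 1) / (1 / A + \<gamma> * h * z powr (\<gamma> - 1))) \<le> y powr (1 - \<gamma>)"
proof -
  define s where "s = A * h * y powr (\<gamma> - 1)"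
  have s: "0 < s" using assms by (simp add: s_def)
  have "y * (1 + s) = y + A * h * y powr \<gamma>"
    using assms by (simp add: s_def powr_diff field_simps)
  then have "y * (1 + s) \<le> x" using le by simp
  then have "x powr (1 - \<gamma>) \<le> (y * (1 + s)) powr (1 - \<gamma>)"
    using assms s by (intro powr_mono2') auto
  also have "\<dots> = y powr (1 - \<gamma>) * ((1 + s) / (1 + s) powr \<gamma>)"
    using assms s by (simp add: powr_mult powr_diff)
  also have "\<dots> \<le> y powr (1 - \<gamma>) * ((1 + s) / (1 + \<gamma> * s))"
    using powr_ge_tangent[of \<gamma> 1 "1 + s"] assms s
    by (intro mult_left_mono divide_left_mono) (auto simp: add_pos_pos)
  also have "(1 + s) / (1 + \<gamma> * s) = 1 - (\<gamma> - 1) * s / (1 + \<gamma> * s)"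
    using add_pos_pos[of 1 "\<gamma> * s"] assms s by (simp add: field_simps)
  finally have 1: "x powr (1 - \<gamma>) \<le> y powr (1 - \<gamma>) - y powr (1 - \<gamma>) * ((\<gamma> - 1) * s / (1 + \<gamma> * s))"
    by (simp add: algebra_simps)
  have ys: "y powr (1 - \<gamma>) * s = A * h"
    using assms by (simp add: s_def mult_ac flip: powr_add)
  have "h * ((\<gamma> - 1) / (1 / A + \<gamma> * h * z powr (\<gamma> - 1))) \<le> h * ((\<gamma> - 1) / (1 / A + \<gamma> * h * y powr (\<gamma> - 1)))"
    using assms by (intro mult_left_mono divide_left_mono add_left_mono powr_mono2) (auto simp: add_pos_pos)
  also have "1 / A + \<gamma> * h * y powr (\<gamma> - 1) = (1 + \<gamma> * s) / A"
    using assms by (simp add: s_def field_simps)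
  also have "h * ((\<gamma> - 1) / ((1 + \<gamma> * s) / A)) = (\<gamma> - 1) * (A * h) / (1 + \<gamma> * s)"
    by simp
  also have "\<dots> = y powr (1 - \<gamma>) * ((\<gamma> - 1) * s / (1 + \<gamma> * s))"
    unfolding ys[symmetric] by simp
  finally show ?thesis using 1 by simp
qed

text \<open>The sequence \<open>e\<close> decreases, so every step may use \<open>z = e 0\<close>:
  the quantity \<open>e j powr (1 - \<gamma>)\<close> grows by at least \<open>h * c\<close> each
  time.\<close>

lemma entropy_recursion:
  fixes e :: "nat \<Rightarrow> real"
  assumes nonneg: "\<And>k. 0 \<le> e k" and A: "0 < A" and h: "0 < h" and g: "1 < \<gamma>"
    and step: "\<And>k. e (Suc k) + A * h * e (Suc k) powr \<gamma> \<le> e k"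
    and c: "c = (\<gamma> - 1) / (1 / A + \<gamma> * h * e 0 powr (\<gamma> - 1))"
  shows "e k \<le> (if e 0 = 0 then 0
    else 1 / (c * (real k * h) + e 0 powr (1 - \<gamma>)) powr (1 / (\<gamma> - 1)))"
proof -
  have "e (Suc k) \<le> e k" for k
    using step[of k] A h by (smt (verit) mult_nonneg_nonneg powr_ge_zero)
  then have anti: "decseq e" by (rule decseq_SucI)
  have c0: "0 < c" unfolding c using A h g by (simp add: add_pos_nonneg)
  show ?thesis
  proof (cases "e k = 0")
    case True
    then show ?thesis by simp
  next
    case False
    \<comment> \<open>Positivity at index \<open>k\<close> passes back to all earlier indices by
      monotonicity, so the negative powers are meaningful.\<close>
    have pos: "0 < e j" if "j \<le> k" for j
      using decseqD[OF anti that] nonneg[of k] False by simp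
    have "c * (real j * h) + e 0 powr (1 - \<gamma>) \<le> e j powr (1 - \<gamma>)" if "j \<le> k" for j
      using that
    proof (induction j)
      case (Suc j)
      have "e j powr (1 - \<gamma>) + h * c \<le> e (Suc j) powr (1 - \<gamma>)"
        unfolding c using Suc.prems A h g by (intro entropy_recursion_step pos step decseqD[OF anti]) auto
      then show ?case using Suc by (simp add: algebra_simps)
    qed simp
    from this[of k] have "c * (real k * h) + e 0 powr (1 - \<gamma>) \<le> e k powr (1 - \<gamma>)" by simp
    moreover have c1: "0 < c * (real k * h) + e 0 powr (1 - \<gamma>)"
      using c0 h pos[of 0] by (intro add_nonneg_pos) auto
    \<comment> \<open>The exponent \<open>- (1 / (\<gamma> - 1))\<close> is the reciprocal of
      \<open>1 - \<gamma>\<close>; being negative, it reverses the inequality.\<close>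
    ultimately have "(e k powr (1 - \<gamma>)) powr (- (1 / (\<gamma> - 1))) \<le>
      (c * (real k * h) + e 0 powr (1 - \<gamma>)) powr (- (1 / (\<gamma> - 1)))"
      using g by (intro powr_mono2') auto
    moreover have "(1 - \<gamma>) * - (1 / (\<gamma> - 1)) = 1" using g by (simp add: field_simps)
    ultimately have "e k \<le> (c * (real k * h) + e 0 powr (1 - \<gamma>)) powr (- (1 / (\<gamma> - 1)))"
      using pos[of k] by (simp add: powr_powr)
    then show ?thesis using pos[of 0] by (simp add: powr_minus_divide)
  qed
qed

section \<open>Integrals of step functions on the mesh\<close>

lemma finite_cells: "admissible_mesh \<Omega> M \<Longrightarrow> finite (cells M)"
  by (simp add: admissible_mesh_def)

lemma admissible_mesh_cells:
  assumes "admissible_mesh \<Omega> M" and "K \<in> cells M"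
  shows "K \<subseteq> \<Omega>" "open K" "convex K" "0 < measure lebesgue K"
  using assms by (auto simp: admissible_mesh_def control_volume_def)

text \<open>The closures of the cells cover the domain, so a point in no cell lies on the frontier
  of some cell; frontiers of convex sets are null.\<close>

lemma negligible_diff_cells:
  assumes "admissible_mesh \<Omega> M"
  shows "negligible (\<Omega> - \<Union>(cells M))"
proof (rule negligible_subset)
  show "negligible (\<Union>K\<in>cells M. frontier K)"
    using finite_cells[OF assms] admissible_mesh_cells(3)[OF assms]
    by (intro negligible_Union) (auto intro!: negligible_convex_frontier)
  have "\<Omega> \<subseteq> (\<Union>K\<in>cells M. closure K)"
    using assms closure_subset[of \<Omega>] by (simp add: admissible_mesh_def)
  then show "\<Omega> - \<Union>(cells M) \<subseteq> (\<Union>K\<in>cells M. frontier K)"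
    using admissible_mesh_cells(2)[OF assms] by (fastforce simp: frontier_def interior_open)
qed

lemma step_fun_eq:
  assumes "admissible_mesh \<Omega> M" "K \<in> cells M" "x \<in> K"
  shows "step_fun M v x = v K"
proof -
  have "x \<notin> L" if "L \<in> cells M" "L \<noteq> K" for L
    using assms that by (auto simp: admissible_mesh_def disjoint_def)
  then have "step_fun M v x = (\<Sum>L\<in>cells M. if L = K then v K else 0)"
    unfolding step_fun_def using assms(3) by (intro sum.cong) (auto simp: indicator_def)
  then show ?thesis using assms by (simp add: admissible_mesh_def)
qed

lemma LINT_step_fun:
  assumes mesh: "admissible_mesh \<Omega> M" and "open \<Omega>" "bounded \<Omega>"
    and g: "g \<in> borel_measurable borel"
  shows "(LINT x:\<Omega>|lebesgue. g (step_fun M v x)) = (\<Sum>K\<in>cells M. measure lebesgue K * g (v K))"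
proof -
  have fin: "finite (cells M)" using mesh by (simp add: admissible_mesh_def)
  have lm: "K \<in> lmeasurable" if "K \<in> cells M" for K
    using admissible_mesh_cells[OF mesh that] assms(3) by (intro lmeasurable_open) (auto intro: bounded_subset)
  then have sets: "K \<in> sets lebesgue" if "K \<in> cells M" for K using that by (auto simp: fmeasurableD)
  have "(LINT x:\<Omega>|lebesgue. g (step_fun M v x)) = (LINT x|lebesgue. (\<Sum>K\<in>cells M. g (v K) * indicator K x))"
    unfolding set_lebesgue_integral_def
  proof (rule integral_cong_AE)
    have step: "step_fun M v \<in> borel_measurable lebesgue"
    proof -
      have "(\<lambda>x. \<Sum>K\<in>cells M. v K * indicat_real K x) \<in> borel_measurable lebesgue"
        using sets by (intro borel_measurable_sum borel_measurable_times borel_measurable_indicator) auto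
      then show ?thesis by (simp add: step_fun_def[abs_def])
    qed
    have "\<Omega> \<in> sets lebesgue" using assms(2) by auto
    then show "(\<lambda>x. indicat_real \<Omega> x *\<^sub>R g (step_fun M v x)) \<in> borel_measurable lebesgue"
      by (intro borel_measurable_scaleR borel_measurable_indicator measurable_compose[OF step g])
    show "(\<lambda>x. \<Sum>K\<in>cells M. g (v K) * indicator K x) \<in> borel_measurable lebesgue"
      using sets by (intro borel_measurable_sum borel_measurable_times borel_measurable_indicator) auto
    \<comment> \<open>At a point of the domain outside all cells the left integrand is
      \<open>g 0\<close> and the right one 0, so equality holds only almost everywhere.\<close>
    have "AE x in lebesgue. x \<notin> \<Omega> - \<Union>(cells M)"
      using negligible_diff_cells[OF mesh] by (intro AE_not_in) (simp add: negligible_iff_null_sets)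
    then show "AE x in lebesgue. indicat_real \<Omega> x *\<^sub>R g (step_fun M v x) = (\<Sum>K\<in>cells M. g (v K) * indicator K x)"
    proof eventually_elim
      case (elim x)
      show ?case
      proof (cases "x \<in> \<Omega>")
        case True
        then obtain K where K: "K \<in> cells M" "x \<in> K" using elim by auto
        then show ?thesis
          using True step_fun_eq[OF mesh K, of "\<lambda>K. g (v K)"] step_fun_eq[OF mesh K, of v]
          by (simp add: step_fun_def)
      next
        case False
        then have "x \<notin> K" if "K \<in> cells M" for K
          using admissible_mesh_cells(1)[OF mesh that] by auto
        then show ?thesis using False by simp
      qed
    qed
  qed
  also have "\<dots> = (\<Sum>K\<in>cells M. LINT x|lebesgue. g (v K) * indicator K x)"
    using lm by (intro Bochner_Integration.integral_sum) (auto simp: lmeasurable_iff_integrable)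
  also have "\<dots> = (\<Sum>K\<in>cells M. measure lebesgue K * g (v K))"
    using sets by (intro sum.cong) (auto simp: mult.commute)
  finally show ?thesis .
qed

section \<open>Summation by parts over the interfaces\<close>

text \<open>The cells \<open>K\<close> and \<open>L\<close> determine their interface as the relative interior of
  the intersection of their closures. Without finiteness the sum in the seminorm would be 0.\<close>

lemma finite_interfaces:
  assumes "admissible_mesh \<Omega> M"
  shows "finite {(\<sigma>, K, L). interface M \<sigma> K L}"
proof (rule finite_subset)
  show "finite ((\<lambda>(K, L). (rel_interior (closure K \<inter> closure L), K, L)) ` (cells M \<times> cells M))"
    using assms by (simp add: admissible_mesh_def)
  have "\<sigma> = rel_interior (closure K \<inter> closure L)" if "interface M \<sigma> K L" for \<sigma> K L
  proof -
    have "mesh_face \<sigma>" "closure K \<inter> closure L = closure \<sigma>"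
      using assms that by (simp_all add: admissible_mesh_def interface_def)
    then show ?thesis by (simp add: mesh_face_def)
  qed
  moreover have "K \<in> cells M" "L \<in> cells M" if "interface M \<sigma> K L" for \<sigma> K L
    using that by (auto simp: interface_def)
  ultimately show "{(\<sigma>, K, L). interface M \<sigma> K L} \<subseteq>
      (\<lambda>(K, L). (rel_interior (closure K \<inter> closure L), K, L)) ` (cells M \<times> cells M)"
    by (auto simp: image_iff)
qed

text \<open>Swapping \<open>K\<close> and \<open>L\<close> permutes the triples and preserves the
  transmissibility, so the sums of \<open>?F\<close> and \<open>?G\<close> agree; their average is
  the symmetric form. Here \<open>\<phi>\<close> plays the role of a test function.\<close>

lemma sum_interfaces_by_parts:
  assumes "admissible_mesh \<Omega> M"
  shows "(\<Sum>K\<in>cells M. \<phi> K * (\<Sum>(\<sigma>, L) \<in> {(\<sigma>, L). interface M \<sigma> K L}.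
      transmissibility M \<sigma> K L * (v K - v L))) =
    1 / 2 * (\<Sum>(\<sigma>, K, L) \<in> {(\<sigma>, K, L). interface M \<sigma> K L}.
      transmissibility M \<sigma> K L * ((\<phi> K - \<phi> L) * (v K - v L)))"
proof -
  let ?T = "{(\<sigma>, K, L). interface M \<sigma> K L}"
  let ?F = "\<lambda>(\<sigma>, K, L). transmissibility M \<sigma> K L * (\<phi> K * (v K - v L))"
  let ?G = "\<lambda>(\<sigma>, K, L). transmissibility M \<sigma> K L * (\<phi> L * (v L - v K))"
  have fin: "finite {(\<sigma>, L). interface M \<sigma> K L}" for K
  proof (rule finite_subset)
    show "{(\<sigma>, L). interface M \<sigma> K L} \<subseteq> (\<lambda>(\<sigma>, K, L). (\<sigma>, L)) ` ?T"
      by (auto simp: image_iff)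
  qed (use finite_interfaces[OF assms] in auto)
  have "(\<Sum>K\<in>cells M. \<phi> K * (\<Sum>(\<sigma>, L) \<in> {(\<sigma>, L). interface M \<sigma> K L}.
      transmissibility M \<sigma> K L * (v K - v L))) =
    (\<Sum>K\<in>cells M. \<Sum>(\<sigma>, L) \<in> {(\<sigma>, L). interface M \<sigma> K L}. ?F (\<sigma>, K, L))"
    by (simp add: sum_distrib_left case_prod_unfold mult_ac)
  also have "\<dots> = (\<Sum>(K, \<sigma>, L) \<in> (SIGMA K:cells M. {(\<sigma>, L). interface M \<sigma> K L}). ?F (\<sigma>, K, L))"
    using assms fin by (subst sum.Sigma) (auto simp: admissible_mesh_def case_prod_unfold)
  also have "\<dots> = sum ?F ?T"
    by (intro sum.reindex_bij_witness[of _ "\<lambda>(\<sigma>, K, L). (K, \<sigma>, L)" "\<lambda>(K, \<sigma>, L). (\<sigma>, K, L)"])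
      (auto simp: interface_def)
  finally have 1: "(\<Sum>K\<in>cells M. \<phi> K * (\<Sum>(\<sigma>, L) \<in> {(\<sigma>, L). interface M \<sigma> K L}.
      transmissibility M \<sigma> K L * (v K - v L))) = sum ?F ?T" .
  have 2: "sum ?F ?T = sum ?G ?T"
    by (intro sum.reindex_bij_witness[of _ "\<lambda>(\<sigma>, K, L). (\<sigma>, L, K)" "\<lambda>(\<sigma>, K, L). (\<sigma>, L, K)"])
      (auto simp: interface_def transmissibility_def dist_commute Int_commute)
  have "(\<Sum>(\<sigma>, K, L) \<in> ?T. transmissibility M \<sigma> K L * ((\<phi> K - \<phi> L) * (v K - v L))) = sum ?F ?T + sum ?G ?T"
    unfolding sum.distrib[symmetric] by (intro sum.cong) (auto simp: algebra_simps)
  then show ?thesis using 1 2 by simp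
qed

lemma transmissibility_nonneg:
  "0 \<le> transmissibility M \<sigma> K L"
  by (simp add: transmissibility_def hyperplane_measure_def)

lemma discrete_H1_seminorm_square:
  "(discrete_H1_seminorm M v)\<^sup>2 = 1 / 2 * (\<Sum>(\<sigma>, K, L) \<in> {(\<sigma>, K, L). interface M \<sigma> K L}.
    transmissibility M \<sigma> K L * \<bar>v K - v L\<bar>\<^sup>2)"
  unfolding discrete_H1_seminorm_def
proof (rule real_sqrt_pow2)
  show "0 \<le> 1 / 2 * (\<Sum>(\<sigma>, K, L) \<in> {(\<sigma>, K, L). interface M \<sigma> K L}.
      transmissibility M \<sigma> K L * \<bar>v K - v L\<bar>\<^sup>2)"
    by (intro mult_nonneg_nonneg sum_nonneg) (simp_all add: split_beta transmissibility_nonneg)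
qed

lemma discrete_H1_seminorm_nonneg: "0 \<le> discrete_H1_seminorm M v"
  unfolding discrete_H1_seminorm_def
  by (intro real_sqrt_ge_zero mult_nonneg_nonneg sum_nonneg)
    (simp_all add: split_beta transmissibility_nonneg)

section \<open>Beckner inequality on the mesh\<close>

lemma sum_measure_cells:
  assumes "admissible_mesh \<Omega> M" "open \<Omega>" "bounded \<Omega>"
  shows "(\<Sum>K\<in>cells M. measure lebesgue K) = measure lebesgue \<Omega>"
proof -
  have "(LINT x:\<Omega>|lebesgue. (1::real)) = measure lebesgue \<Omega>"
    using assms by (simp add: set_lebesgue_integral_def)
  then show ?thesis
    using LINT_step_fun[OF assms, of "\<lambda>_. 1"] by simp
qed

lemma L2_norm_on_step_fun_diff:
  assumes "admissible_mesh \<Omega> M" "open \<Omega>" "bounded \<Omega>"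
  shows "L2_norm_on \<Omega> (\<lambda>x. step_fun M v x - c) = sqrt (\<Sum>K\<in>cells M. measure lebesgue K * (v K - c)\<^sup>2)"
  unfolding L2_norm_on_def using LINT_step_fun[OF assms, of "\<lambda>y. (y - c)\<^sup>2" v] by simp

text \<open>The cell measures are weights of total 1, and the variance \<open>V\<close> is the
  squared L2 distance of the step function from its mean, which the Poincare-Wirtinger inequality
  controls by the seminorm.\<close>

lemma discrete_beckner_inequality:
  assumes mesh: "admissible_mesh \<Omega> M" and \<Omega>: "open \<Omega>" "bounded \<Omega>" "measure lebesgue \<Omega> = 1"
    and regular: "\<xi> > 0" "regular_mesh \<xi> M" and poincare: "poincare_wirtinger_constant \<Omega> C"
    and q: "0 < q" "q < 2" and p: "0 < p" "1 \<le> p * q"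
    and f: "\<And>K. K \<in> cells M \<Longrightarrow> 0 \<le> f K"
  shows "(\<Sum>K\<in>cells M. measure lebesgue K * f K powr q) -
      (\<Sum>K\<in>cells M. measure lebesgue K * f K powr (1 / p)) powr (p * q) \<le>
    beckner_constant C \<xi> p q * discrete_H1_seminorm M f powr q"
proof -
  define N where "N = discrete_H1_seminorm M f"
  define V where "V = (\<Sum>K\<in>cells M. measure lebesgue K *
    (f K - (\<Sum>L\<in>cells M. measure lebesgue L * f L))\<^sup>2)"
  have C: "C > 0" using poincare by (simp add: poincare_wirtinger_constant_def)
  have N: "0 \<le> N"
    unfolding N_def by (rule discrete_H1_seminorm_nonneg)
  have V: "0 \<le> V" unfolding V_def by (intro sum_nonneg) auto
  have "(LINT y:\<Omega>|lebesgue. step_fun M f y) = (\<Sum>L\<in>cells M. measure lebesgue L * f L)"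
    using LINT_step_fun[OF mesh \<Omega>(1,2), of "\<lambda>y. y" f] by simp
  then have "sqrt V \<le> C * \<xi> powr (- 1/2) * N"
    using poincare mesh regular L2_norm_on_step_fun_diff[OF mesh \<Omega>(1,2)]
    unfolding poincare_wirtinger_constant_def V_def N_def by metis
  then have "sqrt V powr q \<le> (C * \<xi> powr (- 1/2) * N) powr q"
    using q V by (intro powr_mono2) auto
  also have "\<dots> = C powr q / \<xi> powr (q / 2) * N powr q"
    using C N by (simp add: powr_mult powr_divide powr_powr powr_minus_divide)
  finally have VN: "V powr (q / 2) \<le> C powr q / \<xi> powr (q / 2) * N powr q"
    unfolding powr_half_sqrt[OF V, symmetric] powr_powr by simp
  have "(\<Sum>K\<in>cells M. measure lebesgue K * f K powr q) -
      (\<Sum>K\<in>cells M. measure lebesgue K * f K powr (1 / p)) powr (p * q) \<le>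
    2 * (p * q - 1) / (2 - q) * V powr (q / 2)"
    unfolding V_def using finite_cells[OF mesh] sum_measure_cells[OF mesh \<Omega>(1,2)] assms
    by (intro weighted_beckner_inequality) auto
  also have "\<dots> \<le> 2 * (p * q - 1) / (2 - q) * (C powr q / \<xi> powr (q / 2) * N powr q)"
    using VN p q by (intro mult_left_mono) auto
  also have "\<dots> = beckner_constant C \<xi> p q * N powr q"
    by (simp add: beckner_constant_def)
  finally show ?thesis by (simp add: N_def)
qed

section \<open>Mass conservation and entropy dissipation of the scheme\<close>

lemma fv_scheme_increment:
  assumes "fv_scheme M \<beta> dt u" "dt > 0" "K \<in> cells M"
  shows "measure lebesgue K * (u (Suc k) K - u k K) =
    - dt * (\<Sum>(\<sigma>, L) \<in> {(\<sigma>, L). interface M \<sigma> K L}.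
      transmissibility M \<sigma> K L * (u (Suc k) K powr \<beta> - u (Suc k) L powr \<beta>))"
    (is "_ = - dt * ?S")
proof -
  have "m * d = - dt * S" if "m * (d / dt) + S = 0" for m d S :: real
    using that assms(2) by (simp add: field_simps)
  moreover have "measure lebesgue K * ((u (Suc k) K - u k K) / dt) + ?S = 0"
    using assms(1,3) unfolding fv_scheme_def by blast
  ultimately show ?thesis by blast
qed

text \<open>Summation by parts with the constant test function 1, whose differences vanish.\<close>

lemma fv_scheme_mass_conservation:
  assumes mesh: "admissible_mesh \<Omega> M" and "fv_scheme M \<beta> dt u" "dt > 0"
  shows "(\<Sum>K\<in>cells M. measure lebesgue K * u (Suc k) K) = (\<Sum>K\<in>cells M. measure lebesgue K * u k K)"
proof -
  have "(\<Sum>K\<in>cells M. measure lebesgue K * (u (Suc k) K - u k K)) =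
    - dt * (\<Sum>K\<in>cells M. 1 * (\<Sum>(\<sigma>, L) \<in> {(\<sigma>, L). interface M \<sigma> K L}.
      transmissibility M \<sigma> K L * (u (Suc k) K powr \<beta> - u (Suc k) L powr \<beta>)))"
    unfolding sum_distrib_left using fv_scheme_increment[OF assms(2,3)]
    by (intro sum.cong) (simp_all add: sum_distrib_left)
  also have "\<dots> = 0"
    unfolding sum_interfaces_by_parts[OF mesh] by simp
  finally show ?thesis by (simp add: sum_subtractf right_diff_distrib)
qed

text \<open>By mass conservation only the convex part of the entropy changes; the test function
  \<open>v K powr \<alpha>\<close> turns its change into a sum over interfaces, bounded face by
  face.\<close>

lemma discrete_entropy_dissipation:
  assumes mesh: "admissible_mesh \<Omega> M" and scheme: "fv_scheme M \<beta> dt u"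
    and params: "dt > 0" "\<alpha> > 0" "\<beta> > 0" and nonneg: "\<And>k K. K \<in> cells M \<Longrightarrow> 0 \<le> u k K"
  shows "discrete_entropy M \<alpha> (u (Suc k)) + dt * (4 * \<alpha> * \<beta> / (\<alpha> + \<beta>)\<^sup>2 *
      (discrete_H1_seminorm M (\<lambda>K. u (Suc k) K powr ((\<alpha> + \<beta>) / 2)))\<^sup>2)
    \<le> discrete_entropy M \<alpha> (u k)"
proof -
  define v where "v = u (Suc k)"
  let ?T = "{(\<sigma>, K, L). interface M \<sigma> K L}"
  have v: "0 \<le> v K" if "K \<in> cells M" for K using nonneg that by (simp add: v_def)
  have "(\<alpha> + 1) * discrete_entropy M \<alpha> v - (\<alpha> + 1) * discrete_entropy M \<alpha> (u k) =
      (\<Sum>K\<in>cells M. measure lebesgue K * (v K powr (\<alpha> + 1) - u k K powr (\<alpha> + 1)))"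
    using fv_scheme_mass_conservation[OF mesh scheme params(1), of k] params
    by (simp add: discrete_entropy_def v_def sum_subtractf right_diff_distrib)
  \<comment> \<open>The tangent is taken at the new value, where the implicit scheme evaluates its
    fluxes.\<close>
  also have "\<dots> \<le> (\<Sum>K\<in>cells M. measure lebesgue K * ((\<alpha> + 1) * v K powr \<alpha> * (v K - u k K)))"
  proof (intro sum_mono mult_left_mono)
    fix K assume "K \<in> cells M"
    then show "v K powr (\<alpha> + 1) - u k K powr (\<alpha> + 1) \<le> (\<alpha> + 1) * v K powr \<alpha> * (v K - u k K)"
      using powr_ge_tangent[of "\<alpha> + 1" "v K" "u k K"] v nonneg params by (simp add: algebra_simps)
  qed auto
  also have "\<dots> = (\<alpha> + 1) * (\<Sum>K\<in>cells M. v K powr \<alpha> * (measure lebesgue K * (v K - u k K)))"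
    by (simp add: sum_distrib_left mult_ac)
  also have "(\<Sum>K\<in>cells M. v K powr \<alpha> * (measure lebesgue K * (v K - u k K))) =
      - dt * (\<Sum>K\<in>cells M. v K powr \<alpha> * (\<Sum>(\<sigma>, L) \<in> {(\<sigma>, L). interface M \<sigma> K L}.
      transmissibility M \<sigma> K L * (v K powr \<beta> - v L powr \<beta>)))"
    unfolding sum_distrib_left[of "- dt"] using fv_scheme_increment[OF scheme params(1), of _ k]
    by (intro sum.cong) (simp_all add: v_def mult.left_commute)
  also have "\<dots> = - dt * (1 / 2 * (\<Sum>(\<sigma>, K, L) \<in> ?T. transmissibility M \<sigma> K L *
      ((v K powr \<alpha> - v L powr \<alpha>) * (v K powr \<beta> - v L powr \<beta>))))"
    by (simp only: sum_interfaces_by_parts[OF mesh])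
  finally have "discrete_entropy M \<alpha> v - discrete_entropy M \<alpha> (u k) \<le>
      - dt * (1 / 2 * (\<Sum>(\<sigma>, K, L) \<in> ?T. transmissibility M \<sigma> K L *
      ((v K powr \<alpha> - v L powr \<alpha>) * (v K powr \<beta> - v L powr \<beta>))))"
    using params by (simp only: right_diff_distrib[symmetric] mult_le_cancel_left_pos[of "\<alpha> + 1"])
  moreover have "dt * (4 * \<alpha> * \<beta> / (\<alpha> + \<beta>)\<^sup>2 * (discrete_H1_seminorm M (\<lambda>K. v K powr ((\<alpha> + \<beta>) / 2)))\<^sup>2) \<le>
      dt * (1 / 2 * (\<Sum>(\<sigma>, K, L) \<in> ?T. transmissibility M \<sigma> K L *
      ((v K powr \<alpha> - v L powr \<alpha>) * (v K powr \<beta> - v L powr \<beta>))))"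
  proof -
    have scale: "dt * (c * (1 / 2 * a)) \<le> dt * (1 / 2 * b)" if "c * a \<le> b" for a b c :: real
      using mult_left_mono[OF that, of "dt / 2"] params by (simp add: mult_ac)
    have "4 * \<alpha> * \<beta> / (\<alpha> + \<beta>)\<^sup>2 * (\<Sum>(\<sigma>, K, L) \<in> ?T. transmissibility M \<sigma> K L *
          \<bar>v K powr ((\<alpha> + \<beta>) / 2) - v L powr ((\<alpha> + \<beta>) / 2)\<bar>\<^sup>2) =
      (\<Sum>(\<sigma>, K, L) \<in> ?T. transmissibility M \<sigma> K L * (4 * \<alpha> * \<beta> / (\<alpha> + \<beta>)\<^sup>2 *
          (v K powr ((\<alpha> + \<beta>) / 2) - v L powr ((\<alpha> + \<beta>) / 2))\<^sup>2))"
      by (simp add: sum_distrib_left split_beta mult_ac)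
    also have "\<dots> \<le> (\<Sum>(\<sigma>, K, L) \<in> ?T. transmissibility M \<sigma> K L *
      ((v K powr \<alpha> - v L powr \<alpha>) * (v K powr \<beta> - v L powr \<beta>)))"
    proof (intro sum_mono, clarify)
      fix \<sigma> K L assume "interface M \<sigma> K L"
      then have "0 \<le> v K" "0 \<le> v L" using v by (auto simp: interface_def)
      then show "transmissibility M \<sigma> K L * (4 * \<alpha> * \<beta> / (\<alpha> + \<beta>)\<^sup>2 *
          (v K powr ((\<alpha> + \<beta>) / 2) - v L powr ((\<alpha> + \<beta>) / 2))\<^sup>2) \<le> transmissibility M \<sigma> K L *
          ((v K powr \<alpha> - v L powr \<alpha>) * (v K powr \<beta> - v L powr \<beta>))"
        using params by (intro mult_left_mono powr_diff_mult_powr_diff_ge transmissibility_nonneg)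
    qed
    finally show ?thesis
      unfolding discrete_H1_seminorm_square by (rule scale)
  qed
  ultimately show ?thesis unfolding v_def by linarith
qed

text \<open>Jensen's inequality with the cell measures as weights.\<close>

lemma discrete_entropy_nonneg:
  assumes "finite (cells M)" "(\<Sum>K\<in>cells M. measure lebesgue K) = 1" "\<alpha> \<ge> 0"
    and "\<And>K. K \<in> cells M \<Longrightarrow> 0 \<le> v K"
  shows "0 \<le> discrete_entropy M \<alpha> v"
  unfolding discrete_entropy_def using assms
  by (intro mult_nonneg_nonneg) (auto intro!: powr_sum_le_sum_powr)

section \<open>Decay of the discrete entropy\<close>

theorem theorem14:
  fixes \<Omega> :: "'a::euclidean_space set"
    and M :: "'a fv_mesh"
    and \<xi> C\<^sub>p dt \<alpha> \<beta> p q c1 c2 :: real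
    and u :: "nat \<Rightarrow> 'a set \<Rightarrow> real"
  assumes dim: "DIM('a) \<ge> 2"
    and domain: "polyhedral_domain \<Omega>" "measure lebesgue \<Omega> = 1"
    and mesh: "admissible_mesh \<Omega> M"
    and regular: "\<xi> > 0" "regular_mesh \<xi> M"
    and poincare: "poincare_wirtinger_constant \<Omega> C\<^sub>p"
    and params: "dt > 0" "\<alpha> > 0" "\<beta> > 1"
    and solution: "fv_scheme M \<beta> dt u"
    and nonneg: "\<forall>k. \<forall>K\<in>cells M. u k K \<ge> 0"
    and initial: "(INF K\<in>cells M. u 0 K) \<ge> 0"
    and p: "p = (\<alpha> + \<beta>) / 2"
    and q: "q = 2 * (\<alpha> + 1) / (\<alpha> + \<beta>)"
    and c1: "c1 = (\<beta> - 1) *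
      inverse ((\<alpha> + 1) * (\<alpha> + \<beta>)\<^sup>2 / (4 * \<alpha> * \<beta>)
                 * (beckner_constant C\<^sub>p \<xi> p q / (\<alpha> + 1)) powr ((\<alpha> + \<beta>) / (\<alpha> + 1))
               + (\<alpha> + \<beta>) * dt * discrete_entropy M \<alpha> (u 0) powr ((\<beta> - 1) / (\<alpha> + 1)))"
    and c2: "c2 = discrete_entropy M \<alpha> (u 0) powr (- (\<beta> - 1) / (\<alpha> + 1))"
  shows "\<forall>k. discrete_entropy M \<alpha> (u k) \<le>
    (if discrete_entropy M \<alpha> (u 0) = 0 then 0
     else 1 / (c1 * (real k * dt) + c2) powr ((\<alpha> + 1) / (\<beta> - 1)))"
proof -
  have \<Omega>: "open \<Omega>" "bounded \<Omega>" using domain by (auto simp: polyhedral_domain_def)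
  have sum1: "(\<Sum>K\<in>cells M. measure lebesgue K) = 1"
    using sum_measure_cells[OF mesh \<Omega>] domain by simp
  \<comment> \<open>For \<open>f = u powr p\<close> this makes \<open>f powr q\<close> the entropy
    density and \<open>f powr (1 / p)\<close> the mass density, so the left side of the Beckner
    inequality is \<open>\<alpha> + 1\<close> times the entropy.\<close>
  have pq: "p * q = \<alpha> + 1" using params by (simp add: p q field_simps)
  have p0: "0 < p" and q0: "0 < q" "q < 2" using params by (auto simp: p q field_simps)
  define \<gamma> where "\<gamma> = (\<alpha> + \<beta>) / (\<alpha> + 1)"
  have \<gamma>: "1 < \<gamma>" "q * \<gamma> = 2" "\<gamma> - 1 = (\<beta> - 1) / (\<alpha> + 1)"
  proof -
    show "1 < \<gamma>" "\<gamma> - 1 = (\<beta> - 1) / (\<alpha> + 1)"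
      using params by (simp_all add: \<gamma>_def field_simps)
    have "\<alpha> + \<beta> \<noteq> 0" "\<alpha> + 1 \<noteq> 0" using params by auto
    then show "q * \<gamma> = 2" unfolding \<gamma>_def q times_divide_times_eq by (simp add: divide_eq_eq)
  qed
  define e where "e = (\<lambda>k. discrete_entropy M \<alpha> (u k))"
  define N where "N = (\<lambda>k. discrete_H1_seminorm M (\<lambda>K. u k K powr p))"
  define B where "B = beckner_constant C\<^sub>p \<xi> p q / (\<alpha> + 1)"
  define D where "D = 4 * \<alpha> * \<beta> / (\<alpha> + \<beta>)\<^sup>2"
  have D: "D > 0" using params by (simp add: D_def)
  have "C\<^sub>p > 0" using poincare by (simp add: poincare_wirtinger_constant_def)
  then have B: "B > 0"
    using params regular q0 by (simp add: B_def beckner_constant_def pq)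
  have e0: "0 \<le> e k" for k
    unfolding e_def using finite_cells[OF mesh] sum1 params nonneg
    by (intro discrete_entropy_nonneg) auto
  have beckner: "e k \<le> B * N k powr q" for k
  proof -
    have "(\<Sum>K\<in>cells M. measure lebesgue K * (u k K powr p) powr q) -
        (\<Sum>K\<in>cells M. measure lebesgue K * (u k K powr p) powr (1 / p)) powr (p * q) \<le>
      beckner_constant C\<^sub>p \<xi> p q * N k powr q"
      unfolding N_def using p0 q0 pq params
      by (intro discrete_beckner_inequality[OF mesh \<Omega> domain(2) regular poincare]) auto
    moreover have "(\<Sum>K\<in>cells M. measure lebesgue K * (u k K powr p) powr (1 / p)) =
        (\<Sum>K\<in>cells M. measure lebesgue K * u k K)"
      using nonneg p0 by (intro sum.cong) (auto simp: powr_powr)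
    ultimately have "(\<alpha> + 1) * e k \<le> beckner_constant C\<^sub>p \<xi> p q * N k powr q"
      using params by (simp add: e_def discrete_entropy_def powr_powr pq)
    then show ?thesis using params by (simp add: B_def field_simps)
  qed
  \<comment> \<open>Because \<open>q * \<gamma> = 2\<close>, the \<open>\<gamma>\<close>-th power of
    the Beckner bound contains the squared seminorm that the dissipation estimate controls.\<close>
  have "e (Suc k) + D / B powr \<gamma> * dt * e (Suc k) powr \<gamma> \<le> e k" for k
  proof -
    have N0: "0 \<le> N (Suc k)"
      unfolding N_def by (rule discrete_H1_seminorm_nonneg)
    have "e (Suc k) powr \<gamma> \<le> (B * N (Suc k) powr q) powr \<gamma>"
      using beckner e0 \<gamma> by (intro powr_mono2) auto
    also have "\<dots> = B powr \<gamma> * (N (Suc k))\<^sup>2"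
      using B N0 by (simp add: powr_mult powr_powr \<gamma>(2))
    finally have "D / B powr \<gamma> * dt * e (Suc k) powr \<gamma> \<le> D / B powr \<gamma> * dt * (B powr \<gamma> * (N (Suc k))\<^sup>2)"
      using D params by (intro mult_left_mono) auto
    also have "\<dots> = dt * (D * (N (Suc k))\<^sup>2)"
      using B by simp
    also have "e (Suc k) + \<dots> \<le> e k"
      unfolding e_def D_def N_def p
      using params nonneg by (intro discrete_entropy_dissipation[OF mesh solution]) auto
    finally show ?thesis by simp
  qed
  \<comment> \<open>Since \<open>\<beta> - 1 = (\<alpha> + 1) * (\<gamma> - 1)\<close> and
    \<open>\<alpha> + \<beta> = (\<alpha> + 1) * \<gamma>\<close>, the factor
    \<open>\<alpha> + 1\<close> cancels from the fraction.\<close>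
  moreover have "c1 = (\<gamma> - 1) / (1 / (D / B powr \<gamma>) + \<gamma> * dt * e 0 powr (\<gamma> - 1))"
  proof -
    have "c1 = (\<beta> - 1) / ((\<alpha> + 1) * (\<alpha> + \<beta>)\<^sup>2 / (4 * \<alpha> * \<beta>) * B powr \<gamma> +
        (\<alpha> + \<beta>) * dt * e 0 powr (\<gamma> - 1))"
      unfolding c1 divide_inverse[of "\<beta> - 1"] \<gamma>(3) e_def B_def unfolding \<gamma>_def by (rule refl)
    also have "(\<alpha> + 1) * (\<alpha> + \<beta>)\<^sup>2 / (4 * \<alpha> * \<beta>) * B powr \<gamma> + (\<alpha> + \<beta>) * dt * e 0 powr (\<gamma> - 1) =
        (\<alpha> + 1) * (1 / (D / B powr \<gamma>) + \<gamma> * dt * e 0 powr (\<gamma> - 1))"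
      using params by (simp add: D_def \<gamma>_def distrib_left)
    finally show ?thesis unfolding \<gamma>(3) by simp
  qed
  ultimately have "e k \<le> (if e 0 = 0 then 0
      else 1 / (c1 * (real k * dt) + e 0 powr (1 - \<gamma>)) powr (1 / (\<gamma> - 1)))" for k
    using e0 D B params \<gamma>(1) by (intro entropy_recursion[where A = "D / B powr \<gamma>"]) auto
  moreover have "1 - \<gamma> = - (\<beta> - 1) / (\<alpha> + 1)"
    using \<gamma>(3) minus_divide_left[of "\<beta> - 1" "\<alpha> + 1"] by linarith
  moreover have "1 / (\<gamma> - 1) = (\<alpha> + 1) / (\<beta> - 1)"
    using \<gamma>(3) by simp
  ultimately show ?thesis by (simp only: e_def c2) simp
qed

end
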